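(* Let $K\subset T=\{(x,y)\in\mathbb{R}^2: 0\le x\le y\}$ be a compact set with $\min\{x:(x,y)\in K\}>0$, and let $E=\{\xi\in\mathbb{R}^{2\times 2}: (\lambda_1(\xi),\lambda_2(\xi))\in K\}$. For $\theta\ge0$ put $m(\theta)=\max_{(a,b)\in K}\{ab+\theta(b-a)\}$. Then $$\operatorname{Rco}E=\Big\{\xi\in\mathbb{R}^{2\times2}: \lambda_1(\xi)\lambda_2(\xi)+\theta(\lambda_2(\xi)-\lambda_1(\xi))\le m(\theta)\ \ \forall\,\theta\in\big[0,\max_{(a,b)\in K}b\big]\Big\}$$ and $$\operatorname{int}\operatorname{Rco}E=\Big\{\xi\in\mathbb{R}^{2\times2}: \lambda_1(\xi)\lambda_2(\xi)+\theta(\lambda_2(\xi)-\lambda_1(\xi))< m(\theta)\ \ \forall\,\theta\in\big[0,\max_{(a,b)\in K}b\big]\Big\}.$$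
   Context: For $\xi\in\mathbb{R}^{2\times2}$, $0\le\lambda_1(\xi)\le\lambda_2(\xi)$ denote the singular values of $\xi$, i.e. the eigenvalues of $\sqrt{\xi\xi^t}$. A function $f:\mathbb{R}^{2\times2}\to\mathbb{R}\cup\{+\infty\}$ is rank one convex if $f(tA+(1-t)B)\le tf(A)+(1-t)f(B)$ for all $t\in[0,1]$ and all $A,B\in\mathbb{R}^{2\times2}$ with $\operatorname{rank}(A-B)\le1$. The rank one convex hull of $E\subseteq\mathbb{R}^{2\times2}$ is $$\operatorname{Rco}E=\{\xi\in\mathbb{R}^{2\times2}: f(\xi)\le0 \text{ for every rank one convex } f:\mathbb{R}^{2\times2}\to\mathbb{R}\cup\{+\infty\}\text{ with } f|_E\le0\}.$$ Equivalently, $\operatorname{Rco}E=\bigcup_{i\in\mathbb{N}}\mathrm{R}_i\mathrm{co}E$, where $\mathrm{R}_0\mathrm{co}E=E$ and $\mathrm{R}_{i+1}\mathrm{co}E=\{tA+(1-t)B: A,B\in\mathrm{R}_i\mathrm{co}E,\ \operatorname{rank}(A-B)\le1,\ t\in[0,1]\}$. (No closure is taken.) $\operatorname{int}$ denotes the topological interior in $\mathbb{R}^{2\times2}$. *)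

theory Defs
  imports "HOL-Analysis.Analysis"
begin

definition psd_matrix :: "real^'n^'n \<Rightarrow> bool" where
  "psd_matrix S \<longleftrightarrow> transpose S = S \<and> (\<forall>v. 0 \<le> v \<bullet> (S *v v))"

text \<open>The principal square root; the description is proper when \<open>A\<close> is positive semidefinite.\<close>

definition matrix_sqrt :: "real^'n^'n \<Rightarrow> real^'n^'n" where
  "matrix_sqrt A = (THE S. psd_matrix S \<and> S ** S = A)"

definition eigenvalues :: "real^'n^'n \<Rightarrow> real set" where
  "eigenvalues A = {\<mu>. \<exists>v. v \<noteq> 0 \<and> A *v v = \<mu> *s v}"

text \<open>A symmetric \<open>2 \<times> 2\<close> matrix has two real eigenvalues counted with multiplicity, so the
  smaller and the larger one are the minimum and the maximum of the set of eigenvalues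
  (a singleton when the two coincide).\<close>

definition sv1 :: "real^2^2 \<Rightarrow> real" where
  "sv1 \<xi> = Min (eigenvalues (matrix_sqrt (\<xi> ** transpose \<xi>)))"

definition sv2 :: "real^2^2 \<Rightarrow> real" where
  "sv2 \<xi> = Max (eigenvalues (matrix_sqrt (\<xi> ** transpose \<xi>)))"

text \<open>Functions into \<open>\<real> \<union> {+\<infinity>}\<close> are extended-real functions avoiding \<open>-\<infinity>\<close>. In \<^typ>\<open>ereal\<close>,
  \<open>0 * \<infinity> = 0\<close>, so the inequality holds trivially for \<open>t = 0\<close> and \<open>t = 1\<close>.\<close>

definition rank_one_convex :: "(real^2^2 \<Rightarrow> ereal) \<Rightarrow> bool" where
  "rank_one_convex f \<longleftrightarrow>
     (\<forall>\<xi>. f \<xi> \<noteq> -\<infinity>) \<and>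
     (\<forall>t\<in>{0..1::real}. \<forall>A B. rank (A - B) \<le> 1 \<longrightarrow>
        f (t *\<^sub>R A + (1 - t) *\<^sub>R B) \<le> ereal t * f A + ereal (1 - t) * f B)"

definition Rco :: "(real^2^2) set \<Rightarrow> (real^2^2) set" where
  "Rco E = {\<xi>. \<forall>f. rank_one_convex f \<and> (\<forall>\<eta>\<in>E. f \<eta> \<le> 0) \<longrightarrow> f \<xi> \<le> 0}"

definition sv_cone :: "(real \<times> real) set" where
  "sv_cone = {(x, y). 0 \<le> x \<and> x \<le> y}"

definition sv_preimage :: "(real \<times> real) set \<Rightarrow> (real^2^2) set" where
  "sv_preimage K = {\<xi>. (sv1 \<xi>, sv2 \<xi>) \<in> K}"

text \<open>For nonempty compact \<open>K\<close> the supremum is attained, i.e. it is a maximum.\<close>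

definition sv_max :: "(real \<times> real) set \<Rightarrow> real \<Rightarrow> real" where
  "sv_max K \<theta> = (SUP (a, b)\<in>K. a * b + \<theta> * (b - a))"

end

theory Submission
  imports Defs
begin

text \<open>
  Identify \<open>\<real>\<^sup>2\<close> with the complex plane. Every real matrix then acts as \<open>z \<mapsto> p z + q z'\<close>, where
  \<open>z'\<close> is the conjugate of \<open>z\<close>, for a unique pair of complex numbers \<open>(p, q)\<close>. In these
  coordinates \<open>det = |p|\<^sup>2 - |q|\<^sup>2\<close>, the singular values are \<open>| |p| - |q| |\<close> and \<open>|p| + |q|\<close>, and
  two matrices are rank-one connected iff their \<open>p\<close>-parts and their \<open>q\<close>-parts have the same
  distance. Write \<open>x \<le> y\<close> for the singular values, \<open>m\<close> for the function that maximises
  \<open>a b + \<theta> (b - a)\<close> over \<open>K\<close>, and \<open>B\<close> for the largest \<open>b\<close> in \<open>K\<close>.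

  \<^emph>\<open>The hull satisfies the inequalities.\<close> The function \<open>x y + \<theta> (y - x)\<close> is in general not
  rank-one convex, but \<open>max (det + 2 \<theta> |q|) (2 \<theta> |p| - det)\<close> is: the determinant is affine along
  rank-one lines and the other terms are convex. This function equals the maximum of
  \<open>x y + \<theta> (y - x)\<close> and \<open>\<theta> (x + y) - x y\<close>. The first term is the larger one when \<open>\<theta> \<le> y\<close>, and
  when \<open>y < \<theta> \<le> B\<close> both lie below \<open>\<theta>\<^sup>2 \<le> m \<theta>\<close>. Hence each inequality of the theorem, strict or
  not, is equivalent to the one for the rank-one convex function (\<open>polyconvex_fun_iff\<close>).

  \<^emph>\<open>The inequalities suffice.\<close> In the variables \<open>s = x y\<close> and \<open>t = y - x\<close> they say that \<open>(s, t)\<close>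
  lies below the support lines of the image of \<open>K\<close>. If \<open>x > 0\<close>, enlarging the greater singular
  value until some support line is reached reduces the problem to a point on such a line, with
  slope parameter \<open>\<theta> \<le> y\<close>. If \<open>0 < \<theta> < B\<close>, this line meets the image of \<open>K\<close> on both sides of
  the point. For \<open>\<theta> = 0\<close> only the side with larger \<open>t\<close> is guaranteed, which is enough because the line can be
  continued through \<open>q = 0\<close>; for \<open>\<theta> = B\<close>, and likewise if \<open>x = 0\<close>, some point of \<open>K\<close> dominates
  \<open>(x, y)\<close> in both coordinates and the last step below suffices. Through every matrix with
  \<open>|q| \<le> |p|\<close> and \<open>\<theta> \<le> |p| + |q|\<close> passes a rank-one line along which \<open>q\<close> moves radially and
  \<open>s + \<theta> t\<close> stays constant (\<open>lam_closed_line\<close>), so the matrix lies on a rank-one segment between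
  two matrices whose singular values are in \<open>K\<close>. Finally either singular value can be lowered,
  because \<open>diag(x, y)\<close> lies between \<open>diag(a, y)\<close> and \<open>diag(-a, y)\<close> if \<open>|x| \<le> a\<close>.

  \<^emph>\<open>The interior.\<close> The strict inequalities define an open set, since \<open>\<theta>\<close> ranges over a compact
  interval. Conversely, the rank-one convex function above has no local maximum, as it grows when
  \<open>|p|\<close> or \<open>|q|\<close> does, so equality cannot occur at an interior point of the hull.
\<close>

section \<open>Complex coordinates and singular values\<close>

text \<open>
  The matrix of the real linear map \<open>z \<mapsto> p z + q z'\<close> of the complex plane, with \<open>z'\<close> the
  conjugate of \<open>z\<close>; \<open>conf\<close> and \<open>anti\<close> recover its conformal and anticonformal parts.
\<close>
definition mat_of :: "complex \<Rightarrow> complex \<Rightarrow> real^2^2" where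
  "mat_of p q = vector [vector [Re p + Re q, Im q - Im p], vector [Im p + Im q, Re p - Re q]]"

definition conf :: "real^2^2 \<Rightarrow> complex" where
  "conf \<xi> = Complex ((\<xi>$1$1 + \<xi>$2$2) / 2) ((\<xi>$2$1 - \<xi>$1$2) / 2)"

definition anti :: "real^2^2 \<Rightarrow> complex" where
  "anti \<xi> = Complex ((\<xi>$1$1 - \<xi>$2$2) / 2) ((\<xi>$2$1 + \<xi>$1$2) / 2)"

lemma mat_of_nth [simp]:
  "mat_of p q $ 1 $ 1 = Re p + Re q" "mat_of p q $ 1 $ 2 = Im q - Im p"
  "mat_of p q $ 2 $ 1 = Im p + Im q" "mat_of p q $ 2 $ 2 = Re p - Re q"
  by (simp_all add: mat_of_def)

lemma conf_mat_of [simp]: "conf (mat_of p q) = p"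
  and anti_mat_of [simp]: "anti (mat_of p q) = q"
  by (simp_all add: conf_def anti_def complex_eq_iff)

lemma mat_of_conf_anti [simp]: "mat_of (conf \<xi>) (anti \<xi>) = \<xi>"
  by (simp add: vec_eq_iff forall_2 conf_def anti_def field_simps)

lemma mat_of_inject [simp]: "mat_of p q = mat_of p' q' \<longleftrightarrow> p = p' \<and> q = q'"
  by (metis conf_mat_of anti_mat_of)

lemma linear_conf: "linear conf" and linear_anti: "linear anti"
  by (auto intro!: linearI simp: conf_def anti_def complex_eq_iff algebra_simps
      add_divide_distrib diff_divide_distrib)

lemma mat_of_add: "mat_of p q + mat_of p' q' = mat_of (p + p') (q + q')"
  and mat_of_diff: "mat_of p q - mat_of p' q' = mat_of (p - p') (q - q')"
  and mat_of_scaleR: "r *\<^sub>R mat_of p q = mat_of (r *\<^sub>R p) (r *\<^sub>R q)"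
  by (simp_all add: vec_eq_iff forall_2 algebra_simps)

lemma mat_of_mult:
  "mat_of p q ** mat_of p' q' = mat_of (p * p' + q * cnj q') (p * q' + q * cnj p')"
  by (simp add: vec_eq_iff forall_2 matrix_matrix_mult_def sum_2 algebra_simps)

lemma transpose_mat_of: "transpose (mat_of p q) = mat_of (cnj p) q"
  by (simp add: vec_eq_iff forall_2 transpose_def)

lemma det_mat_of: "det (mat_of p q) = (cmod p)\<^sup>2 - (cmod q)\<^sup>2"
  by (simp only: cmod_power2 det_2 mat_of_nth) (simp add: algebra_simps power2_eq_square)

lemma det_conf_anti: "det \<xi> = (cmod (conf \<xi>))\<^sup>2 - (cmod (anti \<xi>))\<^sup>2"
  using det_mat_of[of "conf \<xi>" "anti \<xi>"] by simp

lemma rank_le_1_iff: "rank (\<xi> :: real^2^2) \<le> 1 \<longleftrightarrow> cmod (conf \<xi>) = cmod (anti \<xi>)"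
proof -
  have "rank \<xi> \<le> 1 \<longleftrightarrow> det \<xi> = 0"
    by (simp add: det_eq_0_rank less_Suc_eq_le numeral_2_eq_2)
  also have "\<dots> \<longleftrightarrow> cmod (conf \<xi>) = cmod (anti \<xi>)"
    by (simp add: det_conf_anti)
  finally show ?thesis .
qed

text \<open>
  The matrix is symmetric exactly when the conformal part is real; its quadratic form then splits
  into a radial term and a term that depends on the direction only through the square of the
  complex number \<open>v\<close>.
\<close>
lemma inner_mat_of_self:
  "v \<bullet> (mat_of (of_real \<alpha>) \<beta> *v v) = \<alpha> * ((v$1)\<^sup>2 + (v$2)\<^sup>2) + Re (\<beta> * cnj ((Complex (v$1) (v$2))\<^sup>2))"
  by (simp add: inner_vec_def matrix_vector_mult_def sum_2 power2_eq_square algebra_simps)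

text \<open>
  For \<open>q \<noteq> 0\<close> the quadratic form is smallest in the direction of a complex square root of \<open>- q\<close>,
  where it is a positive multiple of \<open>p - |q|\<close>.
\<close>
lemma psd_mat_of_iff:
  "psd_matrix (mat_of p q) \<longleftrightarrow> (\<exists>\<alpha>. p = of_real \<alpha> \<and> cmod q \<le> \<alpha>)"
proof
  assume psd: "psd_matrix (mat_of p q)"
  define \<alpha> where "\<alpha> = Re p"
  have "cnj p = p"
    using psd by (simp add: psd_matrix_def transpose_mat_of)
  then have p: "p = of_real \<alpha>"
    by (simp add: complex_eq_iff \<alpha>_def)
  have pos: "0 \<le> v \<bullet> (mat_of p q *v v)" for v
    using psd by (simp add: psd_matrix_def)
  define z where "z = (if q = 0 then 1 else csqrt (- q))"
  have "(vector [Re z, Im z] :: real^2) $ 1 = Re z" "(vector [Re z, Im z] :: real^2) $ 2 = Im z"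
    by simp_all
  then have "0 \<le> \<alpha> * (cmod z)\<^sup>2 + Re (q * cnj (z\<^sup>2))"
    using pos[of "vector [Re z, Im z]"] by (simp only: p inner_mat_of_self cmod_power2 complex_surj)
  moreover have "Re (q * cnj (z\<^sup>2)) = - (cmod q)\<^sup>2" "(cmod z)\<^sup>2 = cmod q" if "q \<noteq> 0"
  proof -
    have "q * cnj (z\<^sup>2) = - (q * cnj q)"
      using that by (simp add: z_def del: complex_cnj_power)
    then show "Re (q * cnj (z\<^sup>2)) = - (cmod q)\<^sup>2"
      unfolding cmod_power2 by (simp add: power2_eq_square)
    show "(cmod z)\<^sup>2 = cmod q"
      using that by (simp add: z_def flip: norm_power)
  qed
  ultimately have "q \<noteq> 0 \<and> cmod q * cmod q \<le> \<alpha> * cmod q \<or> q = 0 \<and> 0 \<le> \<alpha>"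
    by (cases "q = 0") (auto simp: z_def power2_eq_square)
  then have "cmod q \<le> \<alpha>"
    by (cases "q = 0") auto
  with p show "\<exists>\<alpha>. p = of_real \<alpha> \<and> cmod q \<le> \<alpha>" by blast
next
  assume "\<exists>\<alpha>. p = of_real \<alpha> \<and> cmod q \<le> \<alpha>"
  then obtain \<alpha> where p: "p = of_real \<alpha>" and le: "cmod q \<le> \<alpha>" by blast
  have "0 \<le> v \<bullet> (mat_of p q *v v)" for v
  proof -
    define z where "z = Complex (v$1) (v$2)"
    have "- Re (q * cnj (z\<^sup>2)) \<le> cmod (q * cnj (z\<^sup>2))"
      using abs_Re_le_cmod[of "q * cnj (z\<^sup>2)"] by linarith
    also have "\<dots> = cmod q * (cmod z)\<^sup>2"
      by (simp add: norm_mult norm_power)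
    also have "\<dots> \<le> \<alpha> * (cmod z)\<^sup>2"
      using le by (intro mult_right_mono) auto
    finally show ?thesis
      by (simp only: p inner_mat_of_self z_def cmod_power2) simp
  qed
  then show "psd_matrix (mat_of p q)"
    by (simp add: psd_matrix_def transpose_mat_of p)
qed

lemma square_symmetric_mat_of:
  "mat_of (of_real \<alpha>) \<beta> ** mat_of (of_real \<alpha>) \<beta> =
    mat_of (of_real (\<alpha>\<^sup>2 + (cmod \<beta>)\<^sup>2)) (of_real (2 * \<alpha>) * \<beta>)"
  unfolding mat_of_mult mat_of_inject of_real_add complex_norm_square
  by (simp add: power2_eq_square)

lemma mat_of_mult_transpose:
  "mat_of p q ** transpose (mat_of p q) =
    mat_of (of_real ((cmod p)\<^sup>2 + (cmod q)\<^sup>2)) (2 * (p * q))"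
  unfolding transpose_mat_of mat_of_mult mat_of_inject of_real_add complex_norm_square
  by simp

text \<open>
  For a symmetric matrix with coordinates \<open>\<alpha>\<close> and \<open>\<beta>\<close> the square determines \<open>\<alpha>\<^sup>2 + |\<beta>|\<^sup>2\<close> and
  \<open>\<alpha> \<beta>\<close>, hence \<open>(\<alpha> \<plusminus> |\<beta>|)\<^sup>2\<close>; semidefiniteness means that the numbers being squared are
  nonnegative.
\<close>
lemma psd_sqrt_unique:
  assumes "psd_matrix S" "psd_matrix S'" "S ** S = S' ** (S' :: real^2^2)"
  shows "S = S'"
proof -
  obtain \<alpha> \<beta> where S: "S = mat_of (of_real \<alpha>) \<beta>" and le: "cmod \<beta> \<le> \<alpha>"
    using psd_mat_of_iff[of "conf S" "anti S"] assms(1) by (metis mat_of_conf_anti)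
  obtain \<alpha>' \<beta>' where S': "S' = mat_of (of_real \<alpha>') \<beta>'" and le': "cmod \<beta>' \<le> \<alpha>'"
    using psd_mat_of_iff[of "conf S'" "anti S'"] assms(2) by (metis mat_of_conf_anti)
  from assms(3) have eq: "of_real (\<alpha>\<^sup>2 + (cmod \<beta>)\<^sup>2) = (of_real (\<alpha>'\<^sup>2 + (cmod \<beta>')\<^sup>2) :: complex)"
    and prod: "of_real \<alpha> * \<beta> = of_real \<alpha>' * \<beta>'"
    unfolding S S' square_symmetric_mat_of mat_of_inject by simp_all
  from eq have sq: "\<alpha>\<^sup>2 + (cmod \<beta>)\<^sup>2 = \<alpha>'\<^sup>2 + (cmod \<beta>')\<^sup>2"
    by (simp only: of_real_eq_iff)
  have a: "0 \<le> \<alpha>" "0 \<le> \<alpha>'"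
    using le le' norm_ge_zero[of \<beta>] norm_ge_zero[of \<beta>'] by linarith+
  have nprod: "\<alpha> * cmod \<beta> = \<alpha>' * cmod \<beta>'"
    using arg_cong[OF prod, of cmod] a by (simp add: norm_mult)
  have "(\<alpha> + cmod \<beta>)\<^sup>2 = (\<alpha>' + cmod \<beta>')\<^sup>2" "(\<alpha> - cmod \<beta>)\<^sup>2 = (\<alpha>' - cmod \<beta>')\<^sup>2"
    using sq nprod by (simp_all add: power2_sum power2_diff)
  then have "\<alpha> + cmod \<beta> = \<alpha>' + cmod \<beta>'" "\<alpha> - cmod \<beta> = \<alpha>' - cmod \<beta>'"
    using le le' a by (simp_all add: power2_eq_iff_nonneg)
  then have "\<alpha> = \<alpha>'" "cmod \<beta> = cmod \<beta>'"
    by linarith+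
  moreover have "\<beta> = \<beta>'"
    using prod le le' \<open>\<alpha> = \<alpha>'\<close> by (cases "\<alpha> = 0") auto
  ultimately show ?thesis by (simp add: S S')
qed

text \<open>
  The square root must have coordinates with \<open>\<alpha>\<^sup>2 + |\<beta>|\<^sup>2 = |p|\<^sup>2 + |q|\<^sup>2\<close> and \<open>\<alpha> \<beta> = p q\<close>, which
  leaves \<open>|p|\<close> and \<open>|q|\<close>, the larger one first, for the moduli.
\<close>
lemma matrix_sqrt_mat_of:
  fixes p q :: complex
  defines "\<alpha> \<equiv> max (cmod p) (cmod q)" and "\<beta> \<equiv> of_real (min (cmod p) (cmod q)) * sgn (p * q)"
  shows "matrix_sqrt (mat_of p q ** transpose (mat_of p q)) = mat_of (of_real \<alpha>) \<beta>"
proof -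
  have n\<beta>: "cmod \<beta> = min (cmod p) (cmod q)"
    by (auto simp: \<beta>_def norm_mult norm_sgn min_def)
  have psd: "psd_matrix (mat_of (of_real \<alpha>) \<beta>)"
    unfolding psd_mat_of_iff using n\<beta> by (auto simp: \<alpha>_def)
  have "of_real \<alpha> * \<beta> = p * q"
  proof -
    have "of_real \<alpha> * \<beta> = of_real (cmod p * cmod q) * sgn (p * q)"
      unfolding \<alpha>_def \<beta>_def by (auto simp: max_def min_def)
    also have "\<dots> = p * q"
      by (simp add: sgn_div_norm norm_mult scaleR_conv_of_real divide_simps)
    finally show ?thesis .
  qed
  moreover have "\<alpha>\<^sup>2 + (cmod \<beta>)\<^sup>2 = (cmod p)\<^sup>2 + (cmod q)\<^sup>2"
    unfolding n\<beta> \<alpha>_def by (auto simp: max_def min_def)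
  ultimately have sq: "mat_of (of_real \<alpha>) \<beta> ** mat_of (of_real \<alpha>) \<beta> = mat_of p q ** transpose (mat_of p q)"
    unfolding square_symmetric_mat_of mat_of_mult_transpose by simp
  show ?thesis
    unfolding matrix_sqrt_def
    by (rule the_equality) (use psd sq psd_sqrt_unique in auto)
qed

lemma eigenvalues_mat_of:
  "eigenvalues (mat_of (of_real \<alpha>) \<beta>) = {\<alpha> - cmod \<beta>, \<alpha> + cmod \<beta>}"
proof -
  have "\<mu> \<in> eigenvalues (mat_of (of_real \<alpha>) \<beta>) \<longleftrightarrow> \<mu> = \<alpha> - cmod \<beta> \<or> \<mu> = \<alpha> + cmod \<beta>" for \<mu>
  proof -
    let ?B = "mat_of (of_real (\<alpha> - \<mu>)) \<beta>"
    have "mat_of (of_real \<alpha>) \<beta> *v v = \<mu> *s v \<longleftrightarrow> ?B *v v = 0" for v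
      by (auto simp: vec_eq_iff forall_2 matrix_vector_mult_def sum_2 algebra_simps)
    then have "\<mu> \<in> eigenvalues (mat_of (of_real \<alpha>) \<beta>) \<longleftrightarrow> det ?B = 0"
      using matrix_nonfull_linear_equations_eq[of ?B] rank_bound[of ?B]
      by (auto simp: eigenvalues_def det_eq_0_rank)
    also have "\<dots> \<longleftrightarrow> \<mu> = \<alpha> - cmod \<beta> \<or> \<mu> = \<alpha> + cmod \<beta>"
      by (auto simp add: det_mat_of abs_if simp del: of_real_diff split: if_splits)
    finally show ?thesis .
  qed
  then show ?thesis by blast
qed

lemma sv1_eq: "sv1 \<xi> = \<bar>cmod (conf \<xi>) - cmod (anti \<xi>)\<bar>"
  and sv2_eq: "sv2 \<xi> = cmod (conf \<xi>) + cmod (anti \<xi>)"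
proof -
  let ?p = "conf \<xi>" and ?q = "anti \<xi>"
  define \<beta> where "\<beta> = of_real (min (cmod ?p) (cmod ?q)) * sgn (?p * ?q)"
  have n\<beta>: "cmod \<beta> = min (cmod ?p) (cmod ?q)"
    by (auto simp: \<beta>_def norm_mult norm_sgn min_def)
  have "eigenvalues (matrix_sqrt (\<xi> ** transpose \<xi>)) =
      {max (cmod ?p) (cmod ?q) - cmod \<beta>, max (cmod ?p) (cmod ?q) + cmod \<beta>}"
    using matrix_sqrt_mat_of[of ?p ?q] by (simp add: eigenvalues_mat_of \<beta>_def)
  then show "sv1 \<xi> = \<bar>cmod ?p - cmod ?q\<bar>" "sv2 \<xi> = cmod ?p + cmod ?q"
    unfolding sv1_def sv2_def n\<beta> by (auto simp: max_def min_def)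
qed

section \<open>Rank-one convexity\<close>

lemma mem_Rco: "\<eta> \<in> E \<Longrightarrow> \<eta> \<in> Rco E"
  by (simp add: Rco_def)

lemma Rco_segment:
  assumes "A \<in> Rco E" "B \<in> Rco E" "rank (A - B) \<le> 1" "0 \<le> t" "t \<le> 1"
  shows "t *\<^sub>R A + (1 - t) *\<^sub>R B \<in> Rco E"
  unfolding Rco_def
proof (intro CollectI allI impI)
  fix f assume f: "rank_one_convex f \<and> (\<forall>\<eta>\<in>E. f \<eta> \<le> 0)"
  with assms(1,2) have le: "f A \<le> 0" "f B \<le> 0"
    by (auto simp: Rco_def)
  have "f (t *\<^sub>R A + (1 - t) *\<^sub>R B) \<le> ereal t * f A + ereal (1 - t) * f B"
    using f assms by (auto simp: rank_one_convex_def)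
  also have "\<dots> \<le> 0 + 0"
    using le assms by (intro add_mono) (auto simp: mult_le_0_iff ereal_mult_le_0_iff)
  finally show "f (t *\<^sub>R A + (1 - t) *\<^sub>R B) \<le> 0" by simp
qed

text \<open>
  The bound \<open>c\<close> is arbitrary because subtracting a constant preserves rank-one convexity.
\<close>
lemma Rco_le:
  fixes \<phi> :: "real^2^2 \<Rightarrow> real"
  assumes conv: "\<And>A B t. rank (A - B) \<le> 1 \<Longrightarrow> 0 \<le> t \<Longrightarrow> t \<le> 1 \<Longrightarrow>
      \<phi> (t *\<^sub>R A + (1 - t) *\<^sub>R B) \<le> t * \<phi> A + (1 - t) * \<phi> B"
    and E: "\<And>\<eta>. \<eta> \<in> E \<Longrightarrow> \<phi> \<eta> \<le> c" and "\<xi> \<in> Rco E"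
  shows "\<phi> \<xi> \<le> c"
proof -
  define f where "f \<eta> = ereal (\<phi> \<eta> - c)" for \<eta>
  have "rank_one_convex f"
    unfolding rank_one_convex_def f_def using conv by (auto simp: algebra_simps)
  moreover have "\<forall>\<eta>\<in>E. f \<eta> \<le> 0"
    using E by (simp add: f_def)
  ultimately have "f \<xi> \<le> 0"
    using \<open>\<xi> \<in> Rco E\<close> by (auto simp: Rco_def)
  then show ?thesis by (simp add: f_def)
qed

text \<open>
  In general the identity has the additional term \<open>- t (1 - t) det (A - B)\<close>.
\<close>
lemma det_rank_one_affine:
  fixes A B :: "real^2^2"
  assumes "rank (A - B) \<le> 1"
  shows "det (t *\<^sub>R A + (1 - t) *\<^sub>R B) = t * det A + (1 - t) * det B"
proof -
  have "det (A - B) = 0"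
    using assms unfolding rank_le_1_iff by (simp add: det_conf_anti)
  moreover have "det (t *\<^sub>R A + (1 - t) *\<^sub>R B) = t * det A + (1 - t) * det B - t * (1 - t) * det (A - B)"
    by (simp add: det_2) algebra
  ultimately show ?thesis by simp
qed

text \<open>
  The rank-one convex substitute for \<open>x y + \<theta> (y - x)\<close>. Its two branches are exchanged by
  exchanging the conformal and the anticonformal part, that is, by a reflection.
\<close>
definition polyconvex_fun :: "real \<Rightarrow> real^2^2 \<Rightarrow> real" where
  "polyconvex_fun \<theta> \<xi> = max (det \<xi> + 2 * \<theta> * cmod (anti \<xi>)) (2 * \<theta> * cmod (conf \<xi>) - det \<xi>)"

lemma polyconvex_fun_rank_one_convex:
  assumes "rank (A - B) \<le> 1" "0 \<le> t" "t \<le> 1" "0 \<le> \<theta>"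
  shows "polyconvex_fun \<theta> (t *\<^sub>R A + (1 - t) *\<^sub>R B) \<le> t * polyconvex_fun \<theta> A + (1 - t) * polyconvex_fun \<theta> B"
proof -
  let ?C = "t *\<^sub>R A + (1 - t) *\<^sub>R B"
  have conv: "2 * \<theta> * cmod (g ?C) \<le> t * (2 * \<theta> * cmod (g A)) + (1 - t) * (2 * \<theta> * cmod (g B))"
    if "linear g" for g
  proof -
    have "cmod (g ?C) \<le> t * cmod (g A) + (1 - t) * cmod (g B)"
      using norm_triangle_ineq[of "t *\<^sub>R g A" "(1 - t) *\<^sub>R g B"] assms
      by (simp add: linear_add[OF that] linear_scale[OF that])
    from mult_left_mono[OF this, of "2 * \<theta>"] show ?thesis
      using assms by (simp add: algebra_simps)
  qed
  have "t * (det A + 2 * \<theta> * cmod (anti A)) \<le> t * polyconvex_fun \<theta> A"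
    "t * (2 * \<theta> * cmod (conf A) - det A) \<le> t * polyconvex_fun \<theta> A"
    "(1 - t) * (det B + 2 * \<theta> * cmod (anti B)) \<le> (1 - t) * polyconvex_fun \<theta> B"
    "(1 - t) * (2 * \<theta> * cmod (conf B) - det B) \<le> (1 - t) * polyconvex_fun \<theta> B"
    using assms by (auto intro!: mult_left_mono simp: polyconvex_fun_def)
  with conv[OF linear_anti] conv[OF linear_conf] show ?thesis
    unfolding polyconvex_fun_def[of \<theta> ?C] det_rank_one_affine[OF assms(1)]
    by (auto simp: algebra_simps)
qed

lemma polyconvex_fun_sv:
  "polyconvex_fun \<theta> \<xi> = max (sv1 \<xi> * sv2 \<xi> + \<theta> * (sv2 \<xi> - sv1 \<xi>)) (\<theta> * (sv1 \<xi> + sv2 \<xi>) - sv1 \<xi> * sv2 \<xi>)"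
proof (cases "cmod (anti \<xi>) \<le> cmod (conf \<xi>)")
  case True
  then have "sv1 \<xi> * sv2 \<xi> = det \<xi>" "sv2 \<xi> - sv1 \<xi> = 2 * cmod (anti \<xi>)" "sv1 \<xi> + sv2 \<xi> = 2 * cmod (conf \<xi>)"
    by (simp_all add: sv1_eq sv2_eq det_conf_anti power2_eq_square algebra_simps)
  then show ?thesis
    unfolding polyconvex_fun_def by (simp only: mult.assoc mult.left_commute[of 2])
next
  case False
  then have "sv1 \<xi> * sv2 \<xi> = - det \<xi>" "sv2 \<xi> - sv1 \<xi> = 2 * cmod (conf \<xi>)" "sv1 \<xi> + sv2 \<xi> = 2 * cmod (anti \<xi>)"
    by (simp_all add: sv1_eq sv2_eq det_conf_anti power2_eq_square algebra_simps)
  then show ?thesis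
    unfolding polyconvex_fun_def
    by (simp only: mult.assoc mult.left_commute[of 2] minus_minus diff_minus_eq_add max.commute
        add.commute uminus_add_conv_diff)
qed

lemma sv_bounds: "0 \<le> sv1 \<xi>" "sv1 \<xi> \<le> sv2 \<xi>"
  unfolding sv1_eq sv2_eq using norm_ge_zero[of "conf \<xi>"] norm_ge_zero[of "anti \<xi>"] by linarith+

lemma continuous_polyconvex_fun: "continuous_on UNIV (\<lambda>(\<theta>, \<xi>). polyconvex_fun \<theta> \<xi>)"
proof -
  have 1: "continuous_on UNIV (\<lambda>x :: real \<times> (real^2^2). conf (snd x))"
    using linear_conf
    by (intro bounded_linear.continuous_on[of conf] continuous_intros
        linear_conv_bounded_linear[THEN iffD1])
  have 2: "continuous_on UNIV (\<lambda>x :: real \<times> (real^2^2). anti (snd x))"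
    using linear_anti
    by (intro bounded_linear.continuous_on[of anti] continuous_intros
        linear_conv_bounded_linear[THEN iffD1])
  show ?thesis
    unfolding polyconvex_fun_def det_conf_anti case_prod_beta
    by (rule continuous_on_max; intro continuous_on_add continuous_on_diff continuous_on_mult continuous_on_power
        continuous_on_norm continuous_on_fst continuous_on_const continuous_on_id 1 2)
qed

text \<open>
  In whichever branch attains the maximum, the modulus that enters through the determinant with a
  positive sign can be increased: \<open>|p|\<close> in the first branch, \<open>|q|\<close> in the second.
\<close>
lemma polyconvex_fun_no_local_max:
  assumes "\<xi> \<in> interior S"
  shows "\<exists>\<eta>\<in>S. polyconvex_fun \<theta> \<xi> < polyconvex_fun \<theta> \<eta>"
proof -
  obtain r where r: "r > 0" "ball \<xi> r \<subseteq> S"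
    using assms by (auto simp: mem_interior)
  have nearby: "\<exists>\<delta>>0. \<xi> + \<delta> *\<^sub>R B \<in> S" for B
  proof -
    have "0 < norm B + 1"
      using norm_ge_zero[of B] by linarith
    then have "norm ((r / (norm B + 1)) *\<^sub>R B) < r"
      using r(1) by (simp add: pos_divide_less_eq)
    then have "\<xi> + (r / (norm B + 1)) *\<^sub>R B \<in> ball \<xi> r"
      by (simp add: dist_norm)
    moreover have "0 < r / (norm B + 1)"
      using r(1) \<open>0 < norm B + 1\<close> by simp
    ultimately show ?thesis using r(2) by blast
  qed
  \<comment> \<open>Moving \<open>z\<close> in its own direction increases its modulus at unit speed; at \<open>z = 0\<close> every direction does.\<close>
  have stretch: "\<exists>e. \<forall>\<delta>>0. cmod (z + \<delta> *\<^sub>R e) = cmod z + \<delta>" for z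
  proof (intro exI allI impI)
    fix \<delta> :: real assume "\<delta> > 0"
    define e where "e = (if z = 0 then 1 else sgn z)"
    have "z + \<delta> *\<^sub>R e = (cmod z + \<delta>) *\<^sub>R e"
      by (simp add: e_def sgn_div_norm scaleR_add_left)
    moreover have "cmod e = 1"
      by (simp add: e_def norm_sgn)
    ultimately show "cmod (z + \<delta> *\<^sub>R (if z = 0 then 1 else sgn z)) = cmod z + \<delta>"
      unfolding e_def[symmetric] using \<open>\<delta> > 0\<close> by simp
  qed
  have grow: "c\<^sup>2 < (c + \<delta>)\<^sup>2" if "0 \<le> c" "0 < \<delta>" for c \<delta> :: real
    using that by (intro power_strict_mono) auto
  have split: "\<xi> + \<delta> *\<^sub>R mat_of a b = mat_of (conf \<xi> + \<delta> *\<^sub>R a) (anti \<xi> + \<delta> *\<^sub>R b)" for \<delta> a b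
    using mat_of_add[of "conf \<xi>" "anti \<xi>" "\<delta> *\<^sub>R a" "\<delta> *\<^sub>R b"] by (simp add: mat_of_scaleR)
  show ?thesis
  proof (cases "2 * \<theta> * cmod (conf \<xi>) - det \<xi> \<le> det \<xi> + 2 * \<theta> * cmod (anti \<xi>)")
    case True
    obtain e where e: "\<And>\<delta>. \<delta> > 0 \<Longrightarrow> cmod (conf \<xi> + \<delta> *\<^sub>R e) = cmod (conf \<xi>) + \<delta>"
      using stretch by blast
    obtain \<delta> where "\<delta> > 0" and in_S: "\<xi> + \<delta> *\<^sub>R mat_of e 0 \<in> S" using nearby by blast
    moreover have "polyconvex_fun \<theta> \<xi> < polyconvex_fun \<theta> (\<xi> + \<delta> *\<^sub>R mat_of e 0)"
      using True grow[of "cmod (conf \<xi>)" \<delta>] \<open>\<delta> > 0\<close>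
      unfolding split polyconvex_fun_def conf_mat_of anti_mat_of det_mat_of e[OF \<open>\<delta> > 0\<close>]
      by (simp add: det_conf_anti less_max_iff_disj)
    ultimately show ?thesis by blast
  next
    case False
    obtain e where e: "\<And>\<delta>. \<delta> > 0 \<Longrightarrow> cmod (anti \<xi> + \<delta> *\<^sub>R e) = cmod (anti \<xi>) + \<delta>"
      using stretch by blast
    obtain \<delta> where "\<delta> > 0" and in_S: "\<xi> + \<delta> *\<^sub>R mat_of 0 e \<in> S" using nearby by blast
    moreover have "polyconvex_fun \<theta> \<xi> < polyconvex_fun \<theta> (\<xi> + \<delta> *\<^sub>R mat_of 0 e)"
      using False grow[of "cmod (anti \<xi>)" \<delta>] \<open>\<delta> > 0\<close>
      unfolding split polyconvex_fun_def conf_mat_of anti_mat_of det_mat_of e[OF \<open>\<delta> > 0\<close>]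
      by (simp add: det_conf_anti less_max_iff_disj)
    ultimately show ?thesis by blast
  qed
qed

section \<open>Lamination-closed sets in complex coordinates\<close>

text \<open>
  The equality of distances says that the two matrices are rank-one connected.
\<close>
definition lam_closed :: "(complex \<times> complex) set \<Rightarrow> bool" where
  "lam_closed R \<longleftrightarrow> (\<forall>p q p' q' t. (p, q) \<in> R \<longrightarrow> (p', q') \<in> R \<longrightarrow>
     cmod (p - p') = cmod (q - q') \<longrightarrow> 0 \<le> t \<longrightarrow> t \<le> 1 \<longrightarrow>
     (t *\<^sub>R p + (1 - t) *\<^sub>R p', t *\<^sub>R q + (1 - t) *\<^sub>R q') \<in> R)"

lemma lam_closedD:
  assumes "lam_closed R" "(p, q) \<in> R" "(p', q') \<in> R" "cmod (p - p') = cmod (q - q')" "0 \<le> t" "t \<le> 1"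
    "a = t *\<^sub>R p + (1 - t) *\<^sub>R p'" "b = t *\<^sub>R q + (1 - t) *\<^sub>R q'"
  shows "(a, b) \<in> R"
  using assms unfolding lam_closed_def by blast

text \<open>
  Interchanging the two coordinates preserves the condition on the distances. Hence one may
  restrict attention to symmetric sets, and so to matrices with nonnegative determinant.
\<close>
lemma lam_closed_symmetric_part:
  assumes "lam_closed R"
  shows "lam_closed {(p, q). (p, q) \<in> R \<and> (q, p) \<in> R}"
  unfolding lam_closed_def
proof (intro allI impI, goal_cases)
  case (1 p q p' q' t)
  then have mem: "(p, q) \<in> R" "(p', q') \<in> R" "(q, p) \<in> R" "(q', p') \<in> R" by auto
  have "(t *\<^sub>R p + (1 - t) *\<^sub>R p', t *\<^sub>R q + (1 - t) *\<^sub>R q') \<in> R"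
    by (rule lam_closedD[OF assms mem(1,2) _ 1(4,5)]) (simp_all add: 1(3))
  moreover have "(t *\<^sub>R q + (1 - t) *\<^sub>R q', t *\<^sub>R p + (1 - t) *\<^sub>R p') \<in> R"
    by (rule lam_closedD[OF assms mem(3,4) _ 1(4,5)]) (simp_all add: 1(3))
  ultimately show ?case by simp
qed


lemma lam_closed_Rco: "lam_closed {(p, q). mat_of p q \<in> Rco E}"
  unfolding lam_closed_def
proof (intro allI impI, goal_cases)
  case (1 p q p' q' t)
  then show ?case
    using Rco_segment[of "mat_of p q" E "mat_of p' q'" t]
    unfolding rank_le_1_iff by (simp add: mat_of_diff mat_of_add mat_of_scaleR)
qed

text \<open>
  For \<open>0 \<le> x \<le> y\<close> this says that \<open>R\<close> contains all matrices with singular values \<open>x\<close> and \<open>y\<close> and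
  nonnegative determinant. A negative \<open>x\<close> gives those with singular values \<open>-x\<close> and \<open>y\<close> and
  negative determinant.
\<close>
definition isotropic_in :: "(complex \<times> complex) set \<Rightarrow> real \<Rightarrow> real \<Rightarrow> bool" where
  "isotropic_in R x y \<longleftrightarrow> (\<forall>p q. cmod p - cmod q = x \<longrightarrow> cmod p + cmod q = y \<longrightarrow> (p, q) \<in> R)"

lemma isotropic_inD:
  "isotropic_in R x y \<Longrightarrow> cmod p - cmod q = x \<Longrightarrow> cmod p + cmod q = y \<Longrightarrow> (p, q) \<in> R"
  by (simp add: isotropic_in_def)

lemma unit_direction:
  obtains e where "cmod e = 1" "z = cmod z *\<^sub>R e"
proof
  show "cmod (if z = 0 then 1 else sgn z) = 1" "z = cmod z *\<^sub>R (if z = 0 then 1 else sgn z)"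
    by (simp_all add: norm_sgn sgn_div_norm)
qed

text \<open>
  Up to rotations this is the segment from \<open>diag(x, y)\<close> to \<open>diag(-x, y)\<close>. Keeping the directions
  of \<open>p\<close> and \<open>q\<close>, it runs from the moduli \<open>(u, v)\<close> to \<open>(v, u)\<close>; symmetry provides the second end
  point.
\<close>
lemma isotropic_in_lower_sv1:
  assumes R: "lam_closed R" "sym R" "isotropic_in R x y" and "\<bar>x'\<bar> \<le> x" "x \<le> y"
  shows "isotropic_in R x' y"
proof (cases "x = 0")
  case True
  with assms show ?thesis by simp
next
  case False
  with assms have "0 < x" by linarith
  show ?thesis
    unfolding isotropic_in_def
  proof (intro allI impI)
    fix p q assume pq: "cmod p - cmod q = x'" "cmod p + cmod q = y"
    obtain e where e: "cmod e = 1" "p = cmod p *\<^sub>R e" by (rule unit_direction)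
    obtain d where d: "cmod d = 1" "q = cmod q *\<^sub>R d" by (rule unit_direction)
    define u v where "u = (y + x) / 2" and "v = (y - x) / 2"
    have uv: "0 \<le> u" "0 \<le> v" "u - v = x" "u + v = y"
      using \<open>0 < x\<close> \<open>x \<le> y\<close> by (simp_all add: u_def v_def field_simps)
    define t where "t = (x' + x) / (2 * x)"
    have t: "0 \<le> t" "t \<le> 1" "t * x = (x' + x) / 2"
      using \<open>0 < x\<close> \<open>\<bar>x'\<bar> \<le> x\<close> by (auto simp: t_def field_simps)
    have "(u *\<^sub>R e, v *\<^sub>R d) \<in> R" "(u *\<^sub>R d, v *\<^sub>R e) \<in> R"
      using uv e(1) d(1) by (auto intro!: isotropic_inD[OF R(3)])
    then have "(u *\<^sub>R e, v *\<^sub>R d) \<in> R" "(v *\<^sub>R e, u *\<^sub>R d) \<in> R"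
      using R(2) by (auto dest: symD)
    moreover have "cmod (u *\<^sub>R e - v *\<^sub>R e) = cmod (v *\<^sub>R d - u *\<^sub>R d)"
      using e(1) d(1) by (simp add: abs_minus_commute flip: scaleR_left_diff_distrib)
    moreover have "t * u + (1 - t) * v = cmod p" "t * v + (1 - t) * u = cmod q"
      using t(3) pq unfolding u_def v_def by (simp_all add: field_simps)
    then have "p = t *\<^sub>R u *\<^sub>R e + (1 - t) *\<^sub>R v *\<^sub>R e" "q = t *\<^sub>R v *\<^sub>R d + (1 - t) *\<^sub>R u *\<^sub>R d"
      using e(2) d(2) by (simp_all flip: scaleR_left_distrib)
    ultimately show "(p, q) \<in> R"
      using lam_closedD[OF R(1) _ _ _ t(1,2)] by blast
  qed
qed

text \<open>
  Up to rotations this is the segment from \<open>diag(x, y)\<close> to \<open>diag(x, -y)\<close>: now the signed moduli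
  run from \<open>(u, v)\<close> to \<open>(-v, -u)\<close>.
\<close>
lemma isotropic_in_lower_sv2:
  assumes R: "lam_closed R" "sym R" "isotropic_in R x y" and "0 \<le> x" "x \<le> y'" "y' \<le> y"
  shows "isotropic_in R x y'"
proof (cases "y = 0")
  case True
  with assms have "y' = y" by linarith
  with assms show ?thesis by simp
next
  case False
  with assms have "0 < y" by linarith
  show ?thesis
    unfolding isotropic_in_def
  proof (intro allI impI)
    fix p q assume pq: "cmod p - cmod q = x" "cmod p + cmod q = y'"
    obtain e where e: "cmod e = 1" "p = cmod p *\<^sub>R e" by (rule unit_direction)
    obtain d where d: "cmod d = 1" "q = cmod q *\<^sub>R d" by (rule unit_direction)
    define u v where "u = (y + x) / 2" and "v = (y - x) / 2"
    have uv: "0 \<le> u" "0 \<le> v" "u - v = x" "u + v = y"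
      using assms by (simp_all add: u_def v_def field_simps)
    define t where "t = (y' + y) / (2 * y)"
    have t: "0 \<le> t" "t \<le> 1" "t * y = (y' + y) / 2"
      using \<open>0 < y\<close> assms by (auto simp: t_def field_simps)
    have "(u *\<^sub>R e, v *\<^sub>R d) \<in> R" "((- u) *\<^sub>R d, (- v) *\<^sub>R e) \<in> R"
      using uv e(1) d(1) by (auto intro!: isotropic_inD[OF R(3)])
    then have "(u *\<^sub>R e, v *\<^sub>R d) \<in> R" "((- v) *\<^sub>R e, (- u) *\<^sub>R d) \<in> R"
      using R(2) by (auto dest: symD)
    moreover have "cmod (u *\<^sub>R e - (- v) *\<^sub>R e) = cmod (v *\<^sub>R d - (- u) *\<^sub>R d)"
      unfolding scaleR_left_diff_distrib[symmetric] using e(1) d(1) by simp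
    moreover have "t * u + (1 - t) * (- v) = cmod p" "t * v + (1 - t) * (- u) = cmod q"
      using t(3) pq unfolding u_def v_def by (simp_all add: field_simps)
    then have "p = t *\<^sub>R u *\<^sub>R e + (1 - t) *\<^sub>R (- v) *\<^sub>R e" "q = t *\<^sub>R v *\<^sub>R d + (1 - t) *\<^sub>R (- u) *\<^sub>R d"
      unfolding scaleR_scaleR scaleR_left_distrib[symmetric] using e(2) d(2) by simp_all
    ultimately show "(p, q) \<in> R"
      using lam_closedD[OF R(1) _ _ _ t(1,2)] by blast
  qed
qed

lemma unit_with_inner:
  fixes p :: complex
  assumes "\<bar>c\<bar> \<le> cmod p"
  obtains e where "cmod e = 1" "p \<bullet> e = c"
proof (cases "p = 0")
  case True
  with assms show ?thesis using that[of 1] by simp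
next
  case False
  define d where "d = c / cmod p"
  have "\<bar>d\<bar> \<le> 1"
    using assms False by (simp add: d_def divide_simps)
  then have "d\<^sup>2 \<le> 1"
    by (simp add: abs_square_le_1)
  define e where "e = sgn p * Complex d (sqrt (1 - d\<^sup>2))"
  have "cmod (Complex d (sqrt (1 - d\<^sup>2))) = 1"
    using \<open>d\<^sup>2 \<le> 1\<close> by (simp add: cmod_def)
  then have "cmod e = 1"
    using False by (simp add: e_def norm_mult norm_sgn)
  moreover have "cnj p * e = of_real (cmod p) * Complex d (sqrt (1 - d\<^sup>2))"
  proof -
    have "cnj p * sgn p = of_real (cmod p)"
      using complex_norm_square[of p] False
      by (simp add: sgn_div_norm scaleR_conv_of_real field_simps power2_eq_square)
    then show ?thesis by (simp add: e_def flip: mult.assoc)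
  qed
  then have "Re (cnj p * e) = c"
    using False by (simp add: d_def)
  then have "p \<bullet> e = c"
    by (simp add: inner_complex_def)
  ultimately show ?thesis by (rule that)
qed

text \<open>
  Let \<open>q\<close> move radially at unit speed and \<open>p\<close> along a unit vector \<open>e\<close>. This is a rank-one line,
  and the signed modulus \<open>v\<close> of \<open>q\<close> is an affine parameter on it. The determinant is affine as
  well, with slope \<open>2 (p \<bullet> e - |q|)\<close>, so \<open>det + 2 \<theta> v\<close> is constant once \<open>p \<bullet> e = |q| - \<theta>\<close>. Such a
  vector \<open>e\<close> exists because \<open>||q| - \<theta>| \<le> |p|\<close>. The parameter may become negative, which is why
  the end points are given with absolute values.
\<close>
lemma lam_closed_line:
  assumes R: "lam_closed R"
    and le: "cmod q \<le> cmod p" and \<theta>: "0 \<le> \<theta>" "\<theta> \<le> cmod p + cmod q"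
    and v: "v\<^sub>1 \<le> cmod q" "cmod q \<le> v\<^sub>2" and u: "0 \<le> u\<^sub>1" "0 \<le> u\<^sub>2"
    and R1: "\<And>p q. cmod p = u\<^sub>1 \<Longrightarrow> cmod q = \<bar>v\<^sub>1\<bar> \<Longrightarrow> (p, q) \<in> R"
    and R2: "\<And>p q. cmod p = u\<^sub>2 \<Longrightarrow> cmod q = \<bar>v\<^sub>2\<bar> \<Longrightarrow> (p, q) \<in> R"
    and c1: "u\<^sub>1\<^sup>2 - v\<^sub>1\<^sup>2 + 2 * \<theta> * v\<^sub>1 = (cmod p)\<^sup>2 - (cmod q)\<^sup>2 + 2 * \<theta> * cmod q"
    and c2: "u\<^sub>2\<^sup>2 - v\<^sub>2\<^sup>2 + 2 * \<theta> * v\<^sub>2 = (cmod p)\<^sup>2 - (cmod q)\<^sup>2 + 2 * \<theta> * cmod q"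
  shows "(p, q) \<in> R"
proof -
  obtain e where e: "cmod e = 1" "p \<bullet> e = cmod q - \<theta>"
    by (rule unit_with_inner[of "cmod q - \<theta>" p]) (use le \<theta> in linarith)
  obtain d where d: "cmod d = 1" "q = cmod q *\<^sub>R d" by (rule unit_direction)
  define P Q where "P w = p + (w - cmod q) *\<^sub>R e" and "Q w = q + (w - cmod q) *\<^sub>R d" for w
  have Q: "cmod (Q w) = \<bar>w\<bar>" for w
  proof -
    have "Q w = w *\<^sub>R d"
      unfolding Q_def by (subst (1) d(2)) (simp flip: scaleR_left_distrib)
    then show ?thesis using d(1) by simp
  qed
  have P: "(cmod (P w))\<^sup>2 = (cmod p)\<^sup>2 - (cmod q)\<^sup>2 + 2 * \<theta> * cmod q + w\<^sup>2 - 2 * \<theta> * w" for w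
  proof -
    have "(cmod (P w))\<^sup>2 = (cmod p)\<^sup>2 + 2 * ((w - cmod q) * (p \<bullet> e)) + (w - cmod q)\<^sup>2 * (cmod e)\<^sup>2"
      unfolding P_def power2_norm_eq_inner
      by (simp add: inner_add_left inner_add_right inner_commute power2_eq_square)
    then show ?thesis
      unfolding e by (simp add: power2_eq_square algebra_simps)
  qed
  have "(cmod (P v\<^sub>1))\<^sup>2 = u\<^sub>1\<^sup>2" "(cmod (P v\<^sub>2))\<^sup>2 = u\<^sub>2\<^sup>2"
    using c1 c2 unfolding P by linarith+
  then have "cmod (P v\<^sub>1) = u\<^sub>1" "cmod (P v\<^sub>2) = u\<^sub>2"
    using u by (simp_all add: power2_eq_iff_nonneg)
  then have mem: "(P v\<^sub>1, Q v\<^sub>1) \<in> R" "(P v\<^sub>2, Q v\<^sub>2) \<in> R"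
    using R1 R2 Q by blast+
  show ?thesis
  proof (cases "v\<^sub>1 = v\<^sub>2")
    case True
    with v have "v\<^sub>1 = cmod q" by linarith
    then show ?thesis using mem(1) by (simp add: P_def Q_def)
  next
    case False
    define t where "t = (v\<^sub>2 - cmod q) / (v\<^sub>2 - v\<^sub>1)"
    have t: "0 \<le> t" "t \<le> 1"
      using False v by (simp_all add: t_def divide_simps)
    have "t * (v\<^sub>2 - v\<^sub>1) = v\<^sub>2 - cmod q"
      using False by (simp add: t_def)
    then have zero: "t * (v\<^sub>1 - cmod q) + (1 - t) * (v\<^sub>2 - cmod q) = 0"
      by (simp add: algebra_simps)
    have comb: "z = t *\<^sub>R (z + (v\<^sub>1 - cmod q) *\<^sub>R w) + (1 - t) *\<^sub>R (z + (v\<^sub>2 - cmod q) *\<^sub>R w)" for z w :: complex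
    proof -
      have "t *\<^sub>R (z + (v\<^sub>1 - cmod q) *\<^sub>R w) + (1 - t) *\<^sub>R (z + (v\<^sub>2 - cmod q) *\<^sub>R w) =
          z + (t * (v\<^sub>1 - cmod q) + (1 - t) * (v\<^sub>2 - cmod q)) *\<^sub>R w"
        by (simp add: algebra_simps)
      then show ?thesis by (simp add: zero)
    qed
    have "cmod (P v\<^sub>1 - P v\<^sub>2) = cmod (Q v\<^sub>1 - Q v\<^sub>2)"
      unfolding P_def Q_def add_diff_add diff_self add_0 scaleR_left_diff_distrib[symmetric]
      using d(1) e(1) by simp
    then show ?thesis
      by (rule lam_closedD[OF R mem _ t]) (simp_all only: P_def Q_def flip: comb)
  qed
qed

text \<open>
  In terms of singular values, \<open>s + \<theta> t\<close> takes the same value at \<open>(a\<^sub>1, b\<^sub>1)\<close>, \<open>(x, y)\<close> and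
  \<open>(a\<^sub>2, b\<^sub>2)\<close>. When \<open>\<theta> = 0\<close> the line continues through \<open>q = 0\<close> to a point with opposite \<open>q\<close> and
  the same value of \<open>s + \<theta> t = s\<close>, so that both end points may have the larger value of \<open>t\<close>.
\<close>
lemma isotropic_in_line:
  assumes R: "lam_closed R"
    and xy: "0 \<le> x" and \<theta>: "0 \<le> \<theta>" "\<theta> \<le> y"
    and 1: "isotropic_in R a\<^sub>1 b\<^sub>1" "0 \<le> a\<^sub>1" "a\<^sub>1 \<le> b\<^sub>1" "a\<^sub>1 * b\<^sub>1 + \<theta> * (b\<^sub>1 - a\<^sub>1) = x * y + \<theta> * (y - x)"
      "b\<^sub>1 - a\<^sub>1 \<le> y - x \<or> \<theta> = 0"
    and 2: "isotropic_in R a\<^sub>2 b\<^sub>2" "0 \<le> a\<^sub>2" "a\<^sub>2 \<le> b\<^sub>2" "a\<^sub>2 * b\<^sub>2 + \<theta> * (b\<^sub>2 - a\<^sub>2) = x * y + \<theta> * (y - x)"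
      "y - x \<le> b\<^sub>2 - a\<^sub>2"
  shows "isotropic_in R x y"
  unfolding isotropic_in_def
proof (intro allI impI)
  fix p q assume pq: "cmod p - cmod q = x" "cmod p + cmod q = y"
  then have cq: "cmod q = (y - x) / 2" and cp: "cmod p = (y + x) / 2" by simp_all
  \<comment> \<open>For \<open>\<theta> = 0\<close> the first end point is taken beyond \<open>q = 0\<close>.\<close>
  define s :: real where "s = (if \<theta> = 0 then - 1 else 1)"
  have s: "s\<^sup>2 = 1" "\<bar>s\<bar> = 1" "\<theta> * s = \<theta>" by (auto simp: s_def)
  show "(p, q) \<in> R"
  proof (rule lam_closed_line[OF R, of q p \<theta> "s * ((b\<^sub>1 - a\<^sub>1) / 2)" "(b\<^sub>2 - a\<^sub>2) / 2" "(a\<^sub>1 + b\<^sub>1) / 2" "(a\<^sub>2 + b\<^sub>2) / 2"])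
    show "cmod q \<le> cmod p" using pq xy by linarith
    show "s * ((b\<^sub>1 - a\<^sub>1) / 2) \<le> cmod q"
      using 1 norm_ge_zero[of q] unfolding s_def cq by (auto split: if_splits)
    show "(p, q) \<in> R" if "cmod p = (a\<^sub>1 + b\<^sub>1) / 2" "cmod q = \<bar>s * ((b\<^sub>1 - a\<^sub>1) / 2)\<bar>" for p q
    proof (rule isotropic_inD[OF 1(1)])
      have "cmod q = (b\<^sub>1 - a\<^sub>1) / 2"
        using that(2) 1(3) by (simp add: abs_mult s)
      then show "cmod p - cmod q = a\<^sub>1" "cmod p + cmod q = b\<^sub>1"
        using that(1) by (simp_all add: field_simps)
    qed
    show "(p, q) \<in> R" if "cmod p = (a\<^sub>2 + b\<^sub>2) / 2" "cmod q = \<bar>(b\<^sub>2 - a\<^sub>2) / 2\<bar>" for p q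
      by (rule isotropic_inD[OF 2(1)]) (use that 2 in \<open>simp_all add: field_simps\<close>)
    have *: "((a + b) / 2)\<^sup>2 - ((b - a) / 2)\<^sup>2 + 2 * \<theta> * ((b - a) / 2) = a * b + \<theta> * (b - a)" for a b :: real
      by (simp add: power2_eq_square field_simps)
    have target: "(cmod p)\<^sup>2 - (cmod q)\<^sup>2 + 2 * \<theta> * cmod q = x * y + \<theta> * (y - x)"
      unfolding cp cq by (metis * add.commute)
    show "((a\<^sub>2 + b\<^sub>2) / 2)\<^sup>2 - ((b\<^sub>2 - a\<^sub>2) / 2)\<^sup>2 + 2 * \<theta> * ((b\<^sub>2 - a\<^sub>2) / 2) =
        (cmod p)\<^sup>2 - (cmod q)\<^sup>2 + 2 * \<theta> * cmod q"
      unfolding * target 2(4) ..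
    have "((a\<^sub>1 + b\<^sub>1) / 2)\<^sup>2 - (s * ((b\<^sub>1 - a\<^sub>1) / 2))\<^sup>2 + 2 * \<theta> * (s * ((b\<^sub>1 - a\<^sub>1) / 2)) =
        ((a\<^sub>1 + b\<^sub>1) / 2)\<^sup>2 - s\<^sup>2 * ((b\<^sub>1 - a\<^sub>1) / 2)\<^sup>2 + 2 * (\<theta> * s) * ((b\<^sub>1 - a\<^sub>1) / 2)"
      unfolding power_mult_distrib by (simp only: mult.assoc)
    also have "\<dots> = a\<^sub>1 * b\<^sub>1 + \<theta> * (b\<^sub>1 - a\<^sub>1)"
      unfolding s mult_1_left * ..
    finally show "((a\<^sub>1 + b\<^sub>1) / 2)\<^sup>2 - (s * ((b\<^sub>1 - a\<^sub>1) / 2))\<^sup>2 + 2 * \<theta> * (s * ((b\<^sub>1 - a\<^sub>1) / 2)) =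
        (cmod p)\<^sup>2 - (cmod q)\<^sup>2 + 2 * \<theta> * cmod q"
      unfolding target 1(4) .
  qed (use 1 2 \<theta> pq in \<open>auto simp: cq\<close>)
qed

section \<open>The support function of the set of singular values\<close>

text \<open>
  One-sided first-order condition for a maximum over a compact set: if \<open>F + \<epsilon> H\<close> reaches at least
  \<open>U + \<epsilon> V\<close> for all small \<open>\<epsilon> > 0\<close> while \<open>F \<le> U\<close>, then points where this happens satisfy \<open>H \<ge> V\<close>,
  and they accumulate at a point with \<open>F = U\<close>.
\<close>
lemma supported_point:
  fixes F H :: "'a::metric_space \<Rightarrow> real"
  assumes K: "compact K" and F: "continuous_on K F" and H: "continuous_on K H"
    and le: "\<And>k. k \<in> K \<Longrightarrow> F k \<le> U" and "0 < e"
    and ge: "\<And>\<epsilon>. 0 < \<epsilon> \<Longrightarrow> \<epsilon> \<le> e \<Longrightarrow> \<exists>k\<in>K. U + \<epsilon> * V \<le> F k + \<epsilon> * H k"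
  obtains k where "k \<in> K" "F k = U" "V \<le> H k"
proof -
  define \<epsilon> where "\<epsilon> n = e * inverse (real (Suc n))" for n
  have \<epsilon>: "0 < \<epsilon> n" "\<epsilon> n \<le> e" for n
    using \<open>0 < e\<close> by (simp_all add: \<epsilon>_def divide_simps)
  have "\<forall>n. \<exists>k\<in>K. U + \<epsilon> n * V \<le> F k + \<epsilon> n * H k"
    using ge \<epsilon> by blast
  then obtain k where k: "\<And>n. k n \<in> K" "\<And>n. U + \<epsilon> n * V \<le> F (k n) + \<epsilon> n * H (k n)"
    by metis
  have HV: "V \<le> H (k n)" for n
  proof -
    have "\<epsilon> n * V \<le> \<epsilon> n * H (k n)"
      using le[OF k(1)[of n]] k(2)[of n] by linarith
    then show ?thesis using \<epsilon>(1)[of n] by simp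
  qed
  obtain l r where l: "l \<in> K" and r: "strict_mono r" and lim: "(k \<circ> r) \<longlonglongrightarrow> l"
    using K k(1) unfolding compact_def by metis
  have FH: "(\<lambda>n. F (k (r n))) \<longlonglongrightarrow> F l" "(\<lambda>n. H (k (r n))) \<longlonglongrightarrow> H l"
    using continuous_on_tendsto_compose[OF F lim] continuous_on_tendsto_compose[OF H lim] k(1) l
    by (simp_all add: o_def)
  have "(\<lambda>n. e * inverse (real (Suc n))) \<longlonglongrightarrow> e * 0"
    by (intro tendsto_mult tendsto_const LIMSEQ_inverse_real_of_nat)
  then have "\<epsilon> \<longlonglongrightarrow> 0"
    by (simp add: \<epsilon>_def[abs_def])
  then have "(\<epsilon> \<circ> r) \<longlonglongrightarrow> 0"
    using r by (rule LIMSEQ_subseq_LIMSEQ)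
  then have e0: "(\<lambda>n. \<epsilon> (r n)) \<longlonglongrightarrow> 0"
    by (simp add: o_def)
  have "(\<lambda>n. U + \<epsilon> (r n) * V) \<longlonglongrightarrow> U + 0 * V"
    by (intro tendsto_intros e0)
  moreover have "(\<lambda>n. F (k (r n)) + \<epsilon> (r n) * H (k (r n))) \<longlonglongrightarrow> F l + 0 * H l"
    by (intro tendsto_intros e0 FH)
  ultimately have "U + 0 * V \<le> F l + 0 * H l"
    using k(2) by (intro LIMSEQ_le) auto
  then have "F l = U"
    using le[OF l] by simp
  moreover have "V \<le> H l"
    using FH(2) HV by (intro LIMSEQ_le_const) auto
  ultimately show ?thesis
    using that l by blast
qed

locale sv_set =
  fixes K :: "(real \<times> real) set"
  assumes cone: "K \<subseteq> sv_cone" and cpt: "compact K" and nonempty: "K \<noteq> {}"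
    and inf_pos: "(INF (x, y)\<in>K. x) > 0"
begin

definition bmax :: real where
  "bmax = (SUP (a, b)\<in>K. b)"

lemma in_cone: "(a, b) \<in> K \<Longrightarrow> 0 \<le> a \<and> a \<le> b"
  using cone by (auto simp: sv_cone_def)

lemma bmax_ge: "(a, b) \<in> K \<Longrightarrow> b \<le> bmax"
  and bmax_attained: "\<exists>a. (a, bmax) \<in> K"
proof -
  have cont: "continuous_on K (\<lambda>(a, b). b :: real)"
    unfolding case_prod_beta by (intro continuous_intros)
  have bdd: "bdd_above ((\<lambda>(a, b). b) ` K)"
    using compact_continuous_image[OF cont cpt] by (simp add: bounded_imp_bdd_above compact_imp_bounded)
  have upper: "b \<le> bmax" if "(a, b) \<in> K" for a b
    unfolding bmax_def using cSUP_upper[OF that bdd] by simp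
  then show "(a, b) \<in> K \<Longrightarrow> b \<le> bmax" .
  obtain k where "k \<in> K" "\<forall>k'\<in>K. (case k' of (a, b) \<Rightarrow> b) \<le> (case k of (a, b) \<Rightarrow> b)"
    using continuous_attains_sup[OF cpt nonempty cont] by blast
  moreover obtain a b where "k = (a, b)" by (cases k)
  ultimately have ab: "(a, b) \<in> K" "\<forall>k\<in>K. (case k of (a, b) \<Rightarrow> b) \<le> b" by simp_all
  then have "bmax \<le> b"
    unfolding bmax_def using nonempty by (intro cSUP_least) auto
  with upper[OF ab(1)] ab(1) show "\<exists>a. (a, bmax) \<in> K"
    by (metis antisym)
qed

lemma bmax_pos: "0 < bmax"
proof -
  obtain a where a: "(a, bmax) \<in> K"
    using bmax_attained by blast
  have "bdd_below ((\<lambda>(x, y). x) ` K)"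
    using in_cone by (intro bdd_belowI[of _ 0]) auto
  then have "(INF (x, y)\<in>K. x) \<le> a"
    using cINF_lower[OF _ a, of "\<lambda>(x, y). x"] by simp
  with inf_pos in_cone[OF a] show ?thesis by linarith
qed

lemma continuous_support: "continuous_on K (\<lambda>(a, b). a * b + \<theta> * (b - a) :: real)"
  unfolding case_prod_beta by (intro continuous_intros)

lemma sv_max_ge: "(a, b) \<in> K \<Longrightarrow> a * b + \<theta> * (b - a) \<le> sv_max K \<theta>"
proof -
  have "bdd_above ((\<lambda>(a, b). a * b + \<theta> * (b - a)) ` K)"
    using compact_continuous_image[OF continuous_support cpt]
    by (simp add: bounded_imp_bdd_above compact_imp_bounded)
  then show "(a, b) \<in> K \<Longrightarrow> a * b + \<theta> * (b - a) \<le> sv_max K \<theta>"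
    unfolding sv_max_def using cSUP_upper[of "(a, b)" K "\<lambda>(a, b). a * b + \<theta> * (b - a)"] by simp
qed

lemma sv_max_attained: "\<exists>a b. (a, b) \<in> K \<and> sv_max K \<theta> = a * b + \<theta> * (b - a)"
proof -
  obtain k where "k \<in> K"
    "\<forall>k'\<in>K. (case k' of (a, b) \<Rightarrow> a * b + \<theta> * (b - a)) \<le> (case k of (a, b) \<Rightarrow> a * b + \<theta> * (b - a))"
    using continuous_attains_sup[OF cpt nonempty continuous_support[of \<theta>]] by blast
  moreover obtain a b where "k = (a, b)" by (cases k)
  ultimately have ab: "(a, b) \<in> K"
    "\<forall>k\<in>K. (case k of (a, b) \<Rightarrow> a * b + \<theta> * (b - a)) \<le> a * b + \<theta> * (b - a)" by simp_all
  then have "sv_max K \<theta> \<le> a * b + \<theta> * (b - a)"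
    unfolding sv_max_def using nonempty by (intro cSUP_least) auto
  with sv_max_ge[OF ab(1)] ab(1) show ?thesis
    by (metis antisym)
qed

lemma sv_max_lipschitz: "\<bar>sv_max K \<theta> - sv_max K \<theta>'\<bar> \<le> bmax * \<bar>\<theta> - \<theta>'\<bar>"
proof -
  have "sv_max K \<theta> \<le> sv_max K \<theta>' + bmax * \<bar>\<theta> - \<theta>'\<bar>" for \<theta> \<theta>'
  proof -
    obtain a b where ab: "(a, b) \<in> K" "sv_max K \<theta> = a * b + \<theta> * (b - a)"
      using sv_max_attained by blast
    have "(\<theta> - \<theta>') * (b - a) \<le> \<bar>\<theta> - \<theta>'\<bar> * bmax"
      using in_cone[OF ab(1)] bmax_ge[OF ab(1)] by (intro mult_mono) auto
    with sv_max_ge[OF ab(1), of \<theta>'] ab(2) show ?thesis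
      by (simp add: algebra_simps)
  qed
  from this[of \<theta> \<theta>'] this[of \<theta>' \<theta>] show ?thesis
    by (simp add: abs_minus_commute abs_le_iff)
qed

lemma continuous_sv_max: "continuous_on S (sv_max K)"
proof -
  have "bmax-lipschitz_on S (sv_max K)"
    using sv_max_lipschitz bmax_pos by (intro lipschitz_onI) (auto simp: dist_real_def)
  then show ?thesis
    by (rule lipschitz_on_continuous_on)
qed

text \<open>
  A point of \<open>K\<close> with second coordinate \<open>bmax\<close> contributes \<open>a (bmax - \<theta>) + \<theta> bmax\<close>.
\<close>
lemma sv_max_ge_square:
  assumes "0 \<le> \<theta>" "\<theta> \<le> bmax"
  shows "\<theta>\<^sup>2 \<le> sv_max K \<theta>"
proof -
  obtain a where a: "(a, bmax) \<in> K"
    using bmax_attained by blast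
  have "0 \<le> a * (bmax - \<theta>)" "\<theta> * \<theta> \<le> \<theta> * bmax"
    using in_cone[OF a] assms by (auto intro: mult_left_mono)
  with sv_max_ge[OF a, of \<theta>] show ?thesis
    by (simp add: power2_eq_square algebra_simps)
qed

text \<open>
  The value at a point of \<open>K\<close> falls short of \<open>bmax\<^sup>2\<close> by \<open>(bmax - b) (bmax + a)\<close>.
\<close>
lemma sv_max_bmax: "sv_max K bmax = bmax\<^sup>2"
proof (rule antisym)
  obtain a b where ab: "(a, b) \<in> K" "sv_max K bmax = a * b + bmax * (b - a)"
    using sv_max_attained by blast
  have "0 \<le> (bmax - b) * (bmax + a)"
    using in_cone[OF ab(1)] bmax_ge[OF ab(1)] bmax_pos by (intro mult_nonneg_nonneg) auto
  with ab(2) show "sv_max K bmax \<le> bmax\<^sup>2"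
    by (simp add: power2_eq_square algebra_simps)
qed (use sv_max_ge_square bmax_pos in auto)

text \<open>
  The two sides of the inequality differ by \<open>(bmax - y) (bmax + x)\<close>.
\<close>
lemma bmax_bound_iff:
  assumes "0 \<le> x"
  shows "x * y + bmax * (y - x) \<le> sv_max K bmax \<longleftrightarrow> y \<le> bmax"
proof -
  have "sv_max K bmax - (x * y + bmax * (y - x)) = (bmax - y) * (bmax + x)"
    unfolding sv_max_bmax by (simp add: power2_eq_square algebra_simps)
  moreover have "0 < bmax + x"
    using assms bmax_pos by simp
  ultimately show ?thesis
    by (metis diff_ge_0_iff_ge zero_le_mult_iff not_le less_le)
qed

text \<open>
  The first expression equals \<open>\<theta>\<^sup>2 - (\<theta> - x) (\<theta> - y)\<close>, and the second one is smaller by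
  \<open>2 x (\<theta> - y)\<close>.
\<close>
lemma mirrored_less_sv_max:
  assumes "0 \<le> x" "x \<le> y" "y < \<theta>" "\<theta> \<le> bmax"
  shows "\<theta> * (x + y) - x * y < sv_max K \<theta>" "x * y + \<theta> * (y - x) < sv_max K \<theta>"
proof -
  have "0 < (\<theta> - x) * (\<theta> - y)" "0 \<le> x * (\<theta> - y)"
    using assms by (auto intro!: mult_pos_pos mult_nonneg_nonneg)
  then show "\<theta> * (x + y) - x * y < sv_max K \<theta>" "x * y + \<theta> * (y - x) < sv_max K \<theta>"
    using sv_max_ge_square[of \<theta>] assms by (simp_all add: power2_eq_square algebra_simps)
qed

text \<open>
  For \<open>\<theta> \<le> y\<close> the additional branch of the rank-one convex function is the smaller one; for
  \<open>\<theta> > y\<close> it lies strictly below the bound anyway.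
\<close>
lemma polyconvex_fun_iff:
  assumes "0 \<le> \<theta>" "\<theta> \<le> bmax"
  shows "polyconvex_fun \<theta> \<xi> \<le> sv_max K \<theta> \<longleftrightarrow> sv1 \<xi> * sv2 \<xi> + \<theta> * (sv2 \<xi> - sv1 \<xi>) \<le> sv_max K \<theta>"
    and "polyconvex_fun \<theta> \<xi> < sv_max K \<theta> \<longleftrightarrow> sv1 \<xi> * sv2 \<xi> + \<theta> * (sv2 \<xi> - sv1 \<xi>) < sv_max K \<theta>"
proof -
  let ?f = "sv1 \<xi> * sv2 \<xi> + \<theta> * (sv2 \<xi> - sv1 \<xi>)" and ?g = "\<theta> * (sv1 \<xi> + sv2 \<xi>) - sv1 \<xi> * sv2 \<xi>"
  have "?g \<le> ?f \<or> ?g < sv_max K \<theta>"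
  proof (cases "\<theta> \<le> sv2 \<xi>")
    case True
    then have "0 \<le> sv1 \<xi> * (sv2 \<xi> - \<theta>)"
      using sv_bounds(1) by simp
    then show ?thesis by (simp add: algebra_simps)
  next
    case False
    then show ?thesis
      using mirrored_less_sv_max[of "sv1 \<xi>" "sv2 \<xi>" \<theta>] sv_bounds assms by simp
  qed
  then show "polyconvex_fun \<theta> \<xi> \<le> sv_max K \<theta> \<longleftrightarrow> ?f \<le> sv_max K \<theta>" "polyconvex_fun \<theta> \<xi> < sv_max K \<theta> \<longleftrightarrow> ?f < sv_max K \<theta>"
    unfolding polyconvex_fun_sv by linarith+
qed

lemma Rco_polyconvex_fun_le:
  assumes "\<xi> \<in> Rco (sv_preimage K)" "0 \<le> \<theta>" "\<theta> \<le> bmax"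
  shows "polyconvex_fun \<theta> \<xi> \<le> sv_max K \<theta>"
proof (rule Rco_le[OF _ _ assms(1)])
  show "polyconvex_fun \<theta> \<eta> \<le> sv_max K \<theta>" if "\<eta> \<in> sv_preimage K" for \<eta>
    using that sv_max_ge assms by (simp add: polyconvex_fun_iff sv_preimage_def)
qed (use polyconvex_fun_rank_one_convex assms in auto)

text \<open>
  The complement is the projection of a closed set along the compact parameter interval.
\<close>
lemma open_strict: "open {\<xi>. \<forall>\<theta>\<in>{0..bmax}. polyconvex_fun \<theta> \<xi> < sv_max K \<theta>}"
proof -
  have "continuous_on UNIV (\<lambda>(\<theta>, \<xi> :: real^2^2). sv_max K \<theta>)"
    unfolding case_prod_beta
    by (rule continuous_on_compose2[OF continuous_sv_max[of UNIV]]) (auto intro: continuous_intros)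
  then have "closed {x. (case x of (\<theta>, \<xi>) \<Rightarrow> sv_max K \<theta>) \<le> (case x of (\<theta>, \<xi>) \<Rightarrow> polyconvex_fun \<theta> \<xi>)}"
    using continuous_polyconvex_fun by (intro closed_Collect_le)
  then have "closed {\<xi>. \<exists>\<theta>. \<theta> \<in> {0..bmax} \<and>
      (\<theta>, \<xi>) \<in> {x. (case x of (\<theta>, \<xi>) \<Rightarrow> sv_max K \<theta>) \<le> (case x of (\<theta>, \<xi>) \<Rightarrow> polyconvex_fun \<theta> \<xi>)}}"
    by (intro closed_compact_projection) auto
  moreover have "{\<xi>. \<forall>\<theta>\<in>{0..bmax}. polyconvex_fun \<theta> \<xi> < sv_max K \<theta>} =
      - {\<xi>. \<exists>\<theta>. \<theta> \<in> {0..bmax} \<and>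
      (\<theta>, \<xi>) \<in> {x. (case x of (\<theta>, \<xi>) \<Rightarrow> sv_max K \<theta>) \<le> (case x of (\<theta>, \<xi>) \<Rightarrow> polyconvex_fun \<theta> \<xi>)}}"
    by (simp add: set_eq_iff Ball_def not_le) (meson not_le)
  ultimately show ?thesis
    by (simp add: open_Compl)
qed

section \<open>Reaching the hull by laminates\<close>

text \<open>
  The maximisers over \<open>K\<close> for parameters slightly above \<open>\<theta>\<close> have \<open>b - a\<close> at least \<open>y - x\<close>, since
  the value at \<open>(x, y)\<close> is not exceeded at \<open>\<theta>\<close>; they accumulate on the support line.
\<close>
lemma contact_right:
  assumes "\<And>\<theta>'. \<theta>' \<in> {0..bmax} \<Longrightarrow> x * y + \<theta>' * (y - x) \<le> sv_max K \<theta>'"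
    and "x * y + \<theta> * (y - x) = sv_max K \<theta>" "0 \<le> \<theta>" "\<theta> < bmax"
  obtains a b where "(a, b) \<in> K" "a * b + \<theta> * (b - a) = x * y + \<theta> * (y - x)" "y - x \<le> b - a"
proof -
  obtain k where k: "k \<in> K" "(\<lambda>(a, b). a * b + \<theta> * (b - a)) k = sv_max K \<theta>" "y - x \<le> (\<lambda>(a, b). b - a) k"
  proof (rule supported_point[OF cpt continuous_support[of \<theta>], of "\<lambda>(a, b). b - a" "sv_max K \<theta>" "bmax - \<theta>" "y - x"])
    show "continuous_on K (\<lambda>(a, b). b - a :: real)"
      unfolding case_prod_beta by (intro continuous_intros)
    fix \<epsilon> :: real assume \<epsilon>: "0 < \<epsilon>" "\<epsilon> \<le> bmax - \<theta>"
    obtain a b where ab: "(a, b) \<in> K" "sv_max K (\<theta> + \<epsilon>) = a * b + (\<theta> + \<epsilon>) * (b - a)"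
      using sv_max_attained by blast
    have "x * y + (\<theta> + \<epsilon>) * (y - x) \<le> sv_max K (\<theta> + \<epsilon>)"
      using assms \<epsilon> by simp
    then show "\<exists>k\<in>K. sv_max K \<theta> + \<epsilon> * (y - x) \<le> (case k of (a, b) \<Rightarrow> a * b + \<theta> * (b - a)) + \<epsilon> * (case k of (a, b) \<Rightarrow> b - a)"
      using ab assms(2) by (intro bexI[of _ "(a, b)"]) (simp_all add: algebra_simps)
  qed (use assms sv_max_ge in auto)
  then show ?thesis
    using that assms(2) by (cases k) auto
qed

lemma contact_left:
  assumes "\<And>\<theta>'. \<theta>' \<in> {0..bmax} \<Longrightarrow> x * y + \<theta>' * (y - x) \<le> sv_max K \<theta>'"
    and "x * y + \<theta> * (y - x) = sv_max K \<theta>" "0 < \<theta>" "\<theta> \<le> bmax"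
  obtains a b where "(a, b) \<in> K" "a * b + \<theta> * (b - a) = x * y + \<theta> * (y - x)" "b - a \<le> y - x"
proof -
  obtain k where k: "k \<in> K" "(\<lambda>(a, b). a * b + \<theta> * (b - a)) k = sv_max K \<theta>" "x - y \<le> (\<lambda>(a, b). a - b) k"
  proof (rule supported_point[OF cpt continuous_support[of \<theta>], of "\<lambda>(a, b). a - b" "sv_max K \<theta>" \<theta> "x - y"])
    show "continuous_on K (\<lambda>(a, b). a - b :: real)"
      unfolding case_prod_beta by (intro continuous_intros)
    fix \<epsilon> :: real assume \<epsilon>: "0 < \<epsilon>" "\<epsilon> \<le> \<theta>"
    obtain a b where ab: "(a, b) \<in> K" "sv_max K (\<theta> - \<epsilon>) = a * b + (\<theta> - \<epsilon>) * (b - a)"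
      using sv_max_attained by blast
    have "x * y + (\<theta> - \<epsilon>) * (y - x) \<le> sv_max K (\<theta> - \<epsilon>)"
      using assms \<epsilon> by simp
    then show "\<exists>k\<in>K. sv_max K \<theta> + \<epsilon> * (x - y) \<le> (case k of (a, b) \<Rightarrow> a * b + \<theta> * (b - a)) + \<epsilon> * (case k of (a, b) \<Rightarrow> a - b)"
      using ab assms(2) by (intro bexI[of _ "(a, b)"]) (simp_all add: algebra_simps)
  qed (use assms sv_max_ge in auto)
  then show ?thesis
    using that assms(2) by (cases k) auto
qed

lemma isotropic_in_below:
  assumes R: "lam_closed R" "sym R" and K: "\<And>a b. (a, b) \<in> K \<Longrightarrow> isotropic_in R a b"
    and ab: "(a, b) \<in> K" and "0 \<le> x" "x \<le> y" "x \<le> a" "y \<le> b"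
  shows "isotropic_in R x y"
proof -
  have "isotropic_in R x b"
    using isotropic_in_lower_sv1[OF R K[OF ab]] in_cone[OF ab] assms by simp
  then show ?thesis
    using isotropic_in_lower_sv2[OF R] assms by blast
qed

text \<open>
  The case \<open>\<theta> = bmax\<close> forces \<open>y = bmax\<close> and produces a point of \<open>K\<close> that dominates \<open>(x, y)\<close> in
  both coordinates. For \<open>\<theta> = 0\<close> one point of \<open>K\<close> serves for both ends of the segment, which
  crosses \<open>q = 0\<close>. Otherwise there is a point of \<open>K\<close> on either side.
\<close>
lemma isotropic_in_boundary:
  assumes R: "lam_closed R" "sym R" and K: "\<And>a b. (a, b) \<in> K \<Longrightarrow> isotropic_in R a b"
    and xy: "0 \<le> x" "x \<le> y"
    and le: "\<And>\<theta>. \<theta> \<in> {0..bmax} \<Longrightarrow> x * y + \<theta> * (y - x) \<le> sv_max K \<theta>"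
    and eq: "x * y + \<theta> * (y - x) = sv_max K \<theta>" and \<theta>: "0 \<le> \<theta>" "\<theta> \<le> bmax"
  shows "isotropic_in R x y"
proof -
  \<comment> \<open>Needed for the rank-one line; at a parameter above \<open>y\<close> the inequality would be strict.\<close>
  have "\<theta> \<le> y"
    using mirrored_less_sv_max(2)[of x y \<theta>] xy eq \<theta> by linarith
  consider "\<theta> = bmax" | "\<theta> = 0" "\<theta> < bmax" | "0 < \<theta>" "\<theta> < bmax"
    using \<theta> by linarith
  then show ?thesis
  proof cases
    case 1
    obtain a b where ab: "(a, b) \<in> K" "a * b + \<theta> * (b - a) = x * y + \<theta> * (y - x)" "b - a \<le> y - x"
      using contact_left[OF le eq] 1 bmax_pos by auto
    have "bmax\<^sup>2 - (a * b + bmax * (b - a)) = (bmax - b) * (bmax + a)"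
      by (simp add: power2_eq_square algebra_simps)
    then have "b = bmax"
      using ab(2) eq in_cone[OF ab(1)] bmax_pos by (auto simp: 1 sv_max_bmax)
    moreover have "y \<le> bmax"
      using bmax_bound_iff[of x y] xy le bmax_pos by simp
    ultimately show ?thesis
      using isotropic_in_below[OF R K ab(1), of x y] \<open>\<theta> \<le> y\<close> ab(3) xy 1 by simp
  next
    case 2
    obtain a b where ab: "(a, b) \<in> K" "a * b + \<theta> * (b - a) = x * y + \<theta> * (y - x)" "y - x \<le> b - a"
      using contact_right[OF le eq] 2 by auto
    show ?thesis
      by (rule isotropic_in_line[OF R(1) xy(1) \<theta>(1) \<open>\<theta> \<le> y\<close> K[OF ab(1)] _ _ ab(2) _ K[OF ab(1)] _ _ ab(2,3)])
        (use in_cone[OF ab(1)] 2 in auto)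
  next
    case 3
    obtain a b where ab: "(a, b) \<in> K" "a * b + \<theta> * (b - a) = x * y + \<theta> * (y - x)" "y - x \<le> b - a"
      using contact_right[OF le eq] 3 by auto
    obtain a' b' where ab': "(a', b') \<in> K" "a' * b' + \<theta> * (b' - a') = x * y + \<theta> * (y - x)" "b' - a' \<le> y - x"
      using contact_left[OF le eq] 3 by auto
    show ?thesis
      by (rule isotropic_in_line[OF R(1) xy(1) \<theta>(1) \<open>\<theta> \<le> y\<close> K[OF ab'(1)] _ _ ab'(2) _ K[OF ab(1)] _ _ ab(2,3)])
        (use in_cone[OF ab(1)] in_cone[OF ab'(1)] ab'(3) in auto)
  qed
qed

text \<open>
  For \<open>x > 0\<close> the condition with parameter \<open>\<theta>\<close> is an upper bound \<open>Y \<theta>\<close> on the larger singular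
  value. Where \<open>Y\<close> is minimal, raising \<open>y\<close> to \<open>Y \<theta>\<close> makes that condition an equality and keeps
  all others.
\<close>
lemma isotropic_in_hull:
  assumes R: "lam_closed R" "sym R" and K: "\<And>a b. (a, b) \<in> K \<Longrightarrow> isotropic_in R a b"
    and xy: "0 \<le> x" "x \<le> y"
    and le: "\<And>\<theta>. \<theta> \<in> {0..bmax} \<Longrightarrow> x * y + \<theta> * (y - x) \<le> sv_max K \<theta>"
  shows "isotropic_in R x y"
proof (cases "x = 0")
  case True
  obtain a where a: "(a, bmax) \<in> K"
    using bmax_attained by blast
  moreover have "y \<le> bmax"
    using bmax_bound_iff[of x y] xy le bmax_pos by simp
  ultimately show ?thesis
    using isotropic_in_below[OF R K a] True xy in_cone[OF a] by simp
next
  case False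
  with xy have "0 < x" by simp
  define Y where "Y \<theta> = (sv_max K \<theta> + \<theta> * x) / (x + \<theta>)" for \<theta>
  have Y_iff: "x * z + \<theta> * (z - x) \<le> sv_max K \<theta> \<longleftrightarrow> z \<le> Y \<theta>"
    and Y_eq: "x * Y \<theta> + \<theta> * (Y \<theta> - x) = sv_max K \<theta>" if "0 \<le> \<theta>" for z \<theta>
  proof -
    have "0 < x + \<theta>"
      using \<open>0 < x\<close> that by simp
    then show "x * z + \<theta> * (z - x) \<le> sv_max K \<theta> \<longleftrightarrow> z \<le> Y \<theta>"
      by (simp add: Y_def pos_le_divide_eq algebra_simps)
    have "(x + \<theta>) * Y \<theta> = sv_max K \<theta> + \<theta> * x"
      using \<open>0 < x + \<theta>\<close> by (simp add: Y_def)
    then show "x * Y \<theta> + \<theta> * (Y \<theta> - x) = sv_max K \<theta>"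
      by (simp add: algebra_simps)
  qed
  have "continuous_on {0..bmax} Y"
    unfolding Y_def using \<open>0 < x\<close> by (intro continuous_intros continuous_sv_max) auto
  then obtain \<theta> where \<theta>: "\<theta> \<in> {0..bmax}" "\<And>\<theta>'. \<theta>' \<in> {0..bmax} \<Longrightarrow> Y \<theta> \<le> Y \<theta>'"
    using continuous_attains_inf[of "{0..bmax}" Y] bmax_pos
    by (metis atLeastatMost_empty_iff2 compact_Icc less_le_not_le linear)
  have "y \<le> Y \<theta>"
    using le[OF \<theta>(1)] Y_iff \<theta>(1) by simp
  moreover have "isotropic_in R x (Y \<theta>)"
    by (rule isotropic_in_boundary[OF R K, of _ _ \<theta>]) (use xy \<theta> Y_iff Y_eq \<open>y \<le> Y \<theta>\<close> in auto)
  ultimately show ?thesis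
    using isotropic_in_lower_sv2[OF R] xy by blast
qed

text \<open>
  The symmetric part of the hull contains a matrix exactly when it contains the reflected one, so
  it suffices to reach whichever of the two has nonnegative determinant.
\<close>
lemma mem_Rco_if_sv_bounds:
  assumes "\<And>\<theta>. \<theta> \<in> {0..bmax} \<Longrightarrow> sv1 \<xi> * sv2 \<xi> + \<theta> * (sv2 \<xi> - sv1 \<xi>) \<le> sv_max K \<theta>"
  shows "\<xi> \<in> Rco (sv_preimage K)"
proof -
  let ?H = "{(p, q). mat_of p q \<in> Rco (sv_preimage K)}"
  define R where "R = {(p, q). (p, q) \<in> ?H \<and> (q, p) \<in> ?H}"
  have R: "lam_closed R" "sym R"
    unfolding R_def by (rule lam_closed_symmetric_part[OF lam_closed_Rco]) (auto intro: symI)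
  have "isotropic_in R a b" if "(a, b) \<in> K" for a b
    unfolding isotropic_in_def R_def
    using that in_cone[OF that]
    by (auto intro!: mem_Rco simp: sv_preimage_def sv1_eq sv2_eq abs_minus_commute add.commute)
  then have hull: "isotropic_in R (sv1 \<xi>) (sv2 \<xi>)"
    by (rule isotropic_in_hull[OF R _ sv_bounds assms])
  show ?thesis
  proof (cases "cmod (anti \<xi>) \<le> cmod (conf \<xi>)")
    case True
    then have "(conf \<xi>, anti \<xi>) \<in> R"
      by (intro isotropic_inD[OF hull]) (auto simp: sv1_eq sv2_eq)
    then show ?thesis by (simp add: R_def)
  next
    case False
    then have "(anti \<xi>, conf \<xi>) \<in> R"
      by (intro isotropic_inD[OF hull]) (auto simp: sv1_eq sv2_eq)
    then show ?thesis by (simp add: R_def)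
  qed
qed

lemma Rco_eq:
  "Rco (sv_preimage K) = {\<xi>. \<forall>\<theta>\<in>{0..bmax}. sv1 \<xi> * sv2 \<xi> + \<theta> * (sv2 \<xi> - sv1 \<xi>) \<le> sv_max K \<theta>}"
  using mem_Rco_if_sv_bounds Rco_polyconvex_fun_le by (auto simp: polyconvex_fun_iff)

lemma interior_Rco_eq:
  "interior (Rco (sv_preimage K)) =
    {\<xi>. \<forall>\<theta>\<in>{0..bmax}. sv1 \<xi> * sv2 \<xi> + \<theta> * (sv2 \<xi> - sv1 \<xi>) < sv_max K \<theta>}"
  (is "_ = ?S")
proof
  show "interior (Rco (sv_preimage K)) \<subseteq> ?S"
  proof clarify
    fix \<xi> \<theta> assume "\<xi> \<in> interior (Rco (sv_preimage K))" and \<theta>: "\<theta> \<in> {0..bmax}"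
    then obtain \<eta> where "\<eta> \<in> Rco (sv_preimage K)" "polyconvex_fun \<theta> \<xi> < polyconvex_fun \<theta> \<eta>"
      using polyconvex_fun_no_local_max by blast
    then show "sv1 \<xi> * sv2 \<xi> + \<theta> * (sv2 \<xi> - sv1 \<xi>) < sv_max K \<theta>"
      using Rco_polyconvex_fun_le[of \<eta> \<theta>] polyconvex_fun_iff(2)[of \<theta> \<xi>] \<theta> by simp
  qed
  have S: "?S = {\<xi>. \<forall>\<theta>\<in>{0..bmax}. polyconvex_fun \<theta> \<xi> < sv_max K \<theta>}"
    using polyconvex_fun_iff(2) by auto
  have "?S \<subseteq> Rco (sv_preimage K)"
    unfolding Rco_eq by (auto intro: less_imp_le)
  then show "?S \<subseteq> interior (Rco (sv_preimage K))"
    using open_strict unfolding S[symmetric] by (rule interior_maximal)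
qed

end

theorem theorem3p1:
  fixes K :: "(real \<times> real) set"
  assumes "K \<subseteq> sv_cone" and "compact K" and "K \<noteq> {}"
    and "(INF (x, y)\<in>K. x) > 0"
  shows "Rco (sv_preimage K) =
           {\<xi>. \<forall>\<theta>\<in>{0..(SUP (a, b)\<in>K. b)}.
                 sv1 \<xi> * sv2 \<xi> + \<theta> * (sv2 \<xi> - sv1 \<xi>) \<le> sv_max K \<theta>} \<and>
         interior (Rco (sv_preimage K)) =
           {\<xi>. \<forall>\<theta>\<in>{0..(SUP (a, b)\<in>K. b)}.
                 sv1 \<xi> * sv2 \<xi> + \<theta> * (sv2 \<xi> - sv1 \<xi>) < sv_max K \<theta>}"
proof -
  interpret sv_set K
    using assms by unfold_locales
  show ?thesis
    using Rco_eq interior_Rco_eq unfolding bmax_def by blast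
qed

end
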